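(* Let $q\ge3$ be prime. For each rational $r=\frac{j}{q}$ with $j$ an integer, $1\le j\le\frac{q-1}{2}$, the set $$E\Big(\frac{j}{q}\Big):=\Big\{\mu\in\mathbb{R}:\ \mu\ge0,\ I_\mu\Big(\frac{j}{q}\Big)\text{ is degenerate}\Big\}$$ is a finite set of algebraic numbers.
   Context: For $(a,b)\in\mathbb{R}^2$ let $T_{ab}:\mathbb{R}^2\to\mathbb{R}^2$ be the homeomorphism $T_{ab}(x,y)=(ax-y,x)$ if $x\ge 0$ and $T_{ab}(x,y)=(bx-y,x)$ if $x<0$. The parameters $(\mu,\nu)\in\mathbb{R}^2$ are related to $(a,b)$ by $a=\nu+\mu$, $b=\nu-\mu$; one writes $T_{\mu\nu}$ for the same map $T_{ab}$. $T_{\mu\nu}$ maps rays from the origin to rays from the origin, and it induces the orientation-preserving circle homeomorphism $S_{\mu\nu}:S^1\to S^1$, $S_{\mu\nu}(\mathbf{u})=T_{\mu\nu}(\mathbf{u})/|T_{\mu\nu}(\mathbf{u})|$ (with $S^1$ the unit circle in $\mathbb{R}^2$). Its (counterclockwise) rotation number $r(S_{\mu\nu})\in[0,1)$ is normalized so that a full turn counts as $1$; it is known that it always lies in $[0,\frac12]$. For fixed $\mu\in\mathbb{R}$ and rational $r$ with $0<r<\frac12$, the rotation interval is $I_\mu(r):=\{\nu\in\mathbb{R}: r(S_{\mu\nu})=r\}$. It is known that $I_\mu(r)$ is either a single point or a closed bounded interval of positive length; it is called degenerate if it is a single point, and nondegenerate if it has positive length. *)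

theory Defs
  imports "HOL-Analysis.Analysis" "HOL-Computational_Algebra.Computational_Algebra"
begin

definition T_map :: "real \<Rightarrow> real \<Rightarrow> real \<times> real \<Rightarrow> real \<times> real" where
  "T_map a b = (\<lambda>(x, y). if x \<ge> 0 then (a * x - y, x) else (b * x - y, x))"

definition T_munu :: "real \<Rightarrow> real \<Rightarrow> real \<times> real \<Rightarrow> real \<times> real" where
  "T_munu \<mu> \<nu> = T_map (\<nu> + \<mu>) (\<nu> - \<mu>)"

text \<open>The norm on \<open>real \<times> real\<close> is the Euclidean one. Only the values of this map on the
  unit circle \<open>sphere 0 1\<close> matter below.\<close>
definition S_munu :: "real \<Rightarrow> real \<Rightarrow> real \<times> real \<Rightarrow> real \<times> real" where
  "S_munu \<mu> \<nu> u = T_munu \<mu> \<nu> u /\<^sub>R norm (T_munu \<mu> \<nu> u)"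

text \<open>Counterclockwise parametrization, with one full turn corresponding to an increment of 1.\<close>
definition circle_point :: "real \<Rightarrow> real \<times> real" where
  "circle_point t = (cos (2 * pi * t), sin (2 * pi * t))"

definition is_lift :: "(real \<Rightarrow> real) \<Rightarrow> (real \<times> real \<Rightarrow> real \<times> real) \<Rightarrow> bool" where
  "is_lift F S \<longleftrightarrow>
     continuous_on UNIV F \<and> strict_mono F \<and> (\<forall>t. F (t + 1) = F t + 1) \<and>
     (\<forall>t. S (circle_point t) = circle_point (F t))"

definition translation_number :: "(real \<Rightarrow> real) \<Rightarrow> real" where
  "translation_number F = lim (\<lambda>n. (F ^^ n) 0 / real n)"

text \<open>An orientation-preserving homeomorphism of the circle has a lift, and any two of its lifts
  differ by an integer constant, so the value below exists and is unique; it lies in \<open>[0, 1)\<close>.\<close>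
definition rotation_number :: "(real \<times> real \<Rightarrow> real \<times> real) \<Rightarrow> real" where
  "rotation_number S = (THE r. \<exists>F. is_lift F S \<and> r = frac (translation_number F))"

definition rotation_interval :: "real \<Rightarrow> real \<Rightarrow> real set" where
  "rotation_interval \<mu> r = {\<nu>. rotation_number (S_munu \<mu> \<nu>) = r}"

definition degenerate_params :: "real \<Rightarrow> real set" where
  "degenerate_params r = {\<mu>. \<mu> \<ge> 0 \<and> is_singleton (rotation_interval \<mu> r)}"

end

theory Submission
  imports Defs "HOL-Computational_Algebra.Field_as_Ring" "Subresultants.Subresultant_Gcd"
begin

text \<open>Lifts of $S_{\mu\nu}$ decrease with $\nu$. Hence, if $I_\mu(j/q)$ is a single point $\nu$ and the lift
  $F$ satisfies $F^q(t) \neq t + J$ for some $t$, where $J/q$ is its translation number, then a slight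
  change of $\nu$ in one direction preserves the rotation number, a contradiction. So $T_{\mu\nu}^q$
  fixes every ray. If $\mu \neq 0$, the kink of $T_{\mu\nu}$ on the positive $y$-axis must be compensated,
  so the orbit of $(0,1)$ meets the $y$-axis again at some time $0 < k < q$. The two pieces of the orbit
  give polynomials in $\nu$ over $\mathbb{Z}[\mu]$, monic in $\nu$, that vanish at $(\mu,\nu)$. At $\mu = 0$ they specialize to
  the Chebyshev polynomials $U_{k-1}(\nu/2)$ and $U_{q-k-1}(\nu/2)$, which are coprime because $k$ and $q-k$ are.
  Their resultant with respect to $\nu$ is therefore a nonzero polynomial in $\mu$ with integer
  coefficients, and only finitely many such resultants occur.\<close>

section \<open>Continuants and their resultants\<close>

text \<open>Fundamental solution of \<open>x (n+1) = c n * x n - x (n-1)\<close> with initial values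
  0 and 1. For constant \<open>c\<close> with value \<open>x\<close> it is the Chebyshev polynomial
  \<open>U_(n-1)(x/2)\<close>.\<close>

fun continuant :: "(nat \<Rightarrow> 'a :: comm_ring_1) \<Rightarrow> nat \<Rightarrow> 'a" where
  "continuant c 0 = 0"
| "continuant c (Suc 0) = 1"
| "continuant c (Suc (Suc n)) = c (Suc n) * continuant c (Suc n) - continuant c n"

lemma (in comm_ring_hom) hom_continuant:
  "hom (continuant c n) = continuant (\<lambda>i. hom (c i)) n"
  by (induction c n rule: continuant.induct) (simp_all add: hom_distribs)

text \<open>The product with \<open>[:d i, 1:]\<close> outgrows the subtracted polynomial. Being
  monic keeps the degree fixed when \<mu> is specialized; truncated \<open>n - 1\<close> covers the
  zero polynomial at \<open>n = 0\<close>.\<close>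

lemma monic_continuant:
  fixes d :: "nat \<Rightarrow> 'a :: idom"
  shows "degree (continuant (\<lambda>i. [:d i, 1:]) n) = n - 1 \<and>
    (n > 0 \<longrightarrow> lead_coeff (continuant (\<lambda>i. [:d i, 1:]) n) = 1)"
proof (induction n rule: induct_nat_012)
  case (ge2 n)
  let ?X = "continuant (\<lambda>i. [:d i, 1:])"
  have nz: "?X (Suc n) \<noteq> 0" using ge2.IH(2) by force
  have d1: "degree ([:d (Suc n), 1:] * ?X (Suc n)) = Suc n"
    using ge2.IH(2) nz by (subst degree_mult_eq) auto
  have lt: "degree (- ?X n) < degree ([:d (Suc n), 1:] * ?X (Suc n))"
    using ge2.IH(1) d1 by (cases n) auto
  have l1: "lead_coeff ([:d (Suc n), 1:] * ?X (Suc n)) = 1"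
    using ge2.IH(2) by (subst lead_coeff_mult) auto
  have "degree (?X (Suc (Suc n))) = Suc n"
    using degree_add_eq_left[OF lt] d1 by simp
  moreover have "lead_coeff (?X (Suc (Suc n))) = 1"
    using lead_coeff_add_le l1 lt d1 coeff_eq_0[of "?X n" "Suc n"] calculation by simp
  ultimately show ?case by simp
qed auto

text \<open>With \<open>x = 2 cos a\<close> the continuant is \<open>sin (n a) / sin a\<close>, and
  this is a product-to-sum identity. It shows that a common divisor of the continuants at
  \<open>m + k\<close> and \<open>k\<close> divides the one at \<open>m\<close>.\<close>

lemma continuant_const_diff:
  "continuant (\<lambda>_. x) m =
    continuant (\<lambda>_. x) (m + k) * continuant (\<lambda>_. x) (Suc k) -
    continuant (\<lambda>_. x) (Suc (m + k)) * continuant (\<lambda>_. x) k"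
  by (induction k) (simp_all add: algebra_simps)

text \<open>Subtractive Euclidean algorithm on the indices: a coprime pair descends to 0 and 1, and
  the continuant at 1 is 1.\<close>

lemma continuant_const_coprime:
  assumes "coprime k l" "g dvd continuant (\<lambda>_. x) k" "g dvd continuant (\<lambda>_. x) l"
  shows "g dvd 1"
  using assms
proof (induction "k + l" arbitrary: k l rule: less_induct)
  case less
  have *: "g dvd 1" if "m \<le> n" "m + n = k + l" "coprime m n"
    "g dvd continuant (\<lambda>_. x) m" "g dvd continuant (\<lambda>_. x) n" for m n
  proof (cases "m = 0")
    case True
    then show ?thesis using that by simp
  next
    case False
    have "g dvd continuant (\<lambda>_. x) (n - m)"
      using that continuant_const_diff[of x "n - m" m] by simp
    moreover have "coprime m (n - m)" using that by (metis coprime_iff_gcd_eq_1 gcd.commute gcd_diff1_nat)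
    ultimately show ?thesis using less.hyps[of m "n - m"] that False by simp
  qed
  show ?case using *[of k l] *[of l k] less.prems by (cases "k \<le> l") (auto simp: coprime_commute)
qed

text \<open>The outer variable is $\nu$, the inner one is $\mu$; the coefficients of the recursion are $\nu \pm \mu$.\<close>
definition sign_pattern_poly :: "(nat \<Rightarrow> int) \<Rightarrow> nat \<Rightarrow> int poly poly" where
  "sign_pattern_poly s n = continuant (\<lambda>i. [:[:0, s i:], 1:]) n"

text \<open>Only the signs at indices below \<open>n\<close> enter the polynomial.\<close>

lemma finite_sign_pattern_polys:
  "finite {sign_pattern_poly s n | s. range s \<subseteq> {-1, 1}}"
proof -
  \<comment> \<open>Pairs of consecutive polynomials carry the induction because the recursion has
    second order; each step chooses one more sign.\<close>
  let ?P = "\<lambda>n. {(sign_pattern_poly s n, sign_pattern_poly s (Suc n)) | s. range s \<subseteq> {-1, 1}}"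
  have "finite (?P n)"
  proof (induction n)
    case 0
    have "?P 0 \<subseteq> {(0, 1)}" by (auto simp: sign_pattern_poly_def)
    then show ?case using finite_subset by blast
  next
    case (Suc n)
    have "?P (Suc n) \<subseteq> (\<lambda>((p, p'), e). (p', [:[:0, e:], 1:] * p' - p)) ` (?P n \<times> {-1, 1})"
    proof
      fix z assume "z \<in> ?P (Suc n)"
      then obtain s where s: "range s \<subseteq> {-1, 1}"
        and z: "z = (sign_pattern_poly s (Suc n), sign_pattern_poly s (Suc (Suc n)))" by blast
      have "z = (\<lambda>((p, p'), e). (p', [:[:0, e:], 1:] * p' - p))
          ((sign_pattern_poly s n, sign_pattern_poly s (Suc n)), s (Suc n))"
        unfolding z sign_pattern_poly_def by simp
      moreover have "((sign_pattern_poly s n, sign_pattern_poly s (Suc n)), s (Suc n)) \<in> ?P n \<times> {-1, 1}"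
        using s by blast
      ultimately show "z \<in> (\<lambda>((p, p'), e). (p', [:[:0, e:], 1:] * p' - p)) ` (?P n \<times> {-1, 1})"
        by (rule image_eqI)
    qed
    then show ?case by (rule finite_subset) (simp add: Suc)
  qed
  then have "finite (fst ` ?P n)" by simp
  then show ?thesis by (rule rev_finite_subset) (auto simp: image_iff)
qed

section \<open>Specializing the resultant at a value of \<mu>\<close>

lemma comm_ring_hom_eval_of_int: "comm_ring_hom (\<lambda>p. poly (map_poly real_of_int p) \<mu>)"
  by unfold_locales (auto simp: hom_distribs)

text \<open>A resultant commutes with a homomorphism that preserves both degrees, as it does here
  for monic polynomials. Positive \<open>k\<close> and \<open>l\<close> exclude the zero polynomial
  \<open>continuant c 0\<close>.\<close>

lemma hom_resultant_sign_pattern_poly: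
  fixes h :: "int poly \<Rightarrow> 'a :: idom"
  assumes "comm_ring_hom h"
  assumes "0 < k" "0 < l"
  shows "h (resultant (sign_pattern_poly s k) (sign_pattern_poly t l)) =
    resultant (continuant (\<lambda>i. [:h [:0, s i:], 1:]) k) (continuant (\<lambda>i. [:h [:0, t i:], 1:]) l)"
proof -
  interpret comm_ring_hom h by fact
  interpret m: map_poly_comm_ring_hom h ..
  have *: "map_poly h (sign_pattern_poly s n) = continuant (\<lambda>i. [:h [:0, s i:], 1:]) n" for s n
    unfolding sign_pattern_poly_def m.hom_continuant by simp
  show ?thesis
    by (subst resultant_map_poly[symmetric]; unfold *)
      (simp_all add: sign_pattern_poly_def monic_continuant del: pCons_one)
qed

text \<open>At \<mu> = 0 the signs disappear and both polynomials become Chebyshev polynomials in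
  \<nu>; a vanishing resultant would give them a nonconstant common divisor.\<close>

lemma resultant_sign_pattern_poly_nonzero:
  assumes "coprime k l" "0 < k" "0 < l"
  shows "resultant (sign_pattern_poly s k) (sign_pattern_poly t l) \<noteq> 0"
proof
  assume "resultant (sign_pattern_poly s k) (sign_pattern_poly t l) = 0"
  moreover have "comm_ring_hom (\<lambda>p :: int poly. poly p 0)" by unfold_locales auto
  from hom_resultant_sign_pattern_poly[OF this assms(2,3), of s t]
  have "poly (resultant (sign_pattern_poly s k) (sign_pattern_poly t l)) 0 =
    resultant (continuant (\<lambda>i. [:0::int, 1:]) k) (continuant (\<lambda>i. [:0, 1:]) l)" by simp
  ultimately have *: "degree (gcd (continuant (\<lambda>i. [:0::int, 1:]) k) (continuant (\<lambda>i. [:0, 1:]) l)) \<noteq> 0"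
    unfolding resultant_0_gcd[symmetric] by simp
  have "gcd (continuant (\<lambda>i. [:0::int, 1:]) k) (continuant (\<lambda>i. [:0, 1:]) l) dvd 1"
    using continuant_const_coprime[OF assms(1)] gcd_dvd1 gcd_dvd2 by blast
  with * show False by (simp add: poly_dvd_1)
qed

text \<open>The common root \<nu> gives the specialized polynomials the common factor
  \<open>[:- \<nu>, 1:]\<close>, so their resultant vanishes.\<close>

lemma resultant_sign_pattern_poly_root:
  fixes \<mu> \<nu> :: real
  assumes "continuant (\<lambda>i. \<nu> + real_of_int (s i) * \<mu>) k = 0" "continuant (\<lambda>i. \<nu> + real_of_int (t i) * \<mu>) l = 0" "0 < k" "0 < l"
  shows "poly (map_poly real_of_int (resultant (sign_pattern_poly s k) (sign_pattern_poly t l))) \<mu> = 0"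
proof -
  have *: "[:- \<nu>, 1:] dvd continuant (\<lambda>i. [:r i * \<mu>, 1:]) n"
    if "continuant (\<lambda>i. \<nu> + r i * \<mu>) n = 0" for r :: "nat \<Rightarrow> int" and n
  proof -
    have "comm_ring_hom (\<lambda>p. poly p \<nu>)" by unfold_locales auto
    from comm_ring_hom.hom_continuant[OF this, of "\<lambda>i. [:r i * \<mu>, 1:]" n] that
    have "poly (continuant (\<lambda>i. [:r i * \<mu>, 1:]) n) \<nu> = 0" by (simp add: add.commute)
    then show ?thesis unfolding poly_eq_0_iff_dvd .
  qed
  let ?f = "continuant (\<lambda>i. [:s i * \<mu>, 1:]) k" and ?g = "continuant (\<lambda>i. [:t i * \<mu>, 1:]) l"
  have "[:- \<nu>, 1:] dvd gcd ?f ?g" using *[OF assms(1)] *[OF assms(2)] by simp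
  moreover have "?f \<noteq> 0" using monic_continuant[of "\<lambda>i. s i * \<mu>" k] assms by auto
  ultimately have "degree (gcd ?f ?g) \<noteq> 0"
    using dvd_imp_degree_le[of "[:- \<nu>, 1:]" "gcd ?f ?g"] by auto
  then have "resultant ?f ?g = 0" using resultant_0_gcd by blast
  moreover have "poly (map_poly real_of_int [:0, e:]) \<mu> = e * \<mu>" for e
    by (simp add: of_int_hom.map_poly_pCons_hom)
  ultimately show ?thesis using hom_resultant_sign_pattern_poly[OF comm_ring_hom_eval_of_int[of \<mu>] assms(3,4), of s t] by simp
qed

text \<open>The two sign sequences are quantified independently because the itineraries of the two
  orbit pieces are not known in advance.\<close>

definition double_root_params :: "nat \<Rightarrow> nat \<Rightarrow> real set" where
  "double_root_params k l = {\<mu>. \<exists>\<nu>. \<exists>s t :: nat \<Rightarrow> int. range s \<subseteq> {-1, 1} \<and> range t \<subseteq> {-1, 1} \<and>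
    continuant (\<lambda>i. \<nu> + real_of_int (s i) * \<mu>) k = 0 \<and> continuant (\<lambda>i. \<nu> + real_of_int (t i) * \<mu>) l = 0}"

text \<open>Each such \<mu> is a root of one of finitely many nonzero integer polynomials, the
  resultants over all pairs of sign patterns.\<close>

lemma finite_algebraic_double_root_params:
  assumes "coprime k l" "0 < k" "0 < l"
  shows "finite (double_root_params k l)" "\<forall>\<mu> \<in> double_root_params k l. algebraic \<mu>"
proof -
  define S where "S n = {sign_pattern_poly s n | s. range s \<subseteq> {-1, 1}}" for n
  define Q where "Q = (\<lambda>(p, p'). map_poly real_of_int (resultant p p')) ` (S k \<times> S l)"
  have "finite Q"
    unfolding Q_def S_def by (intro finite_imageI finite_cartesian_product finite_sign_pattern_polys)
  have nz: "r \<noteq> 0" if "r \<in> Q" for r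
    using that resultant_sign_pattern_poly_nonzero[OF assms] unfolding Q_def S_def by auto
  have root: "\<exists>r \<in> Q. poly r \<mu> = 0" if "\<mu> \<in> double_root_params k l" for \<mu>
  proof -
    from that obtain \<nu> and s t :: "nat \<Rightarrow> int" where st: "range s \<subseteq> {-1, 1}" "range t \<subseteq> {-1, 1}"
      and eq: "continuant (\<lambda>i. \<nu> + real_of_int (s i) * \<mu>) k = 0" "continuant (\<lambda>i. \<nu> + real_of_int (t i) * \<mu>) l = 0"
      unfolding double_root_params_def mem_Collect_eq by (elim exE conjE)
    have "(sign_pattern_poly s k, sign_pattern_poly t l) \<in> S k \<times> S l"
      using st by (auto simp: S_def)
    then have "map_poly real_of_int (resultant (sign_pattern_poly s k) (sign_pattern_poly t l)) \<in> Q"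
      unfolding Q_def by (rule rev_image_eqI) simp
    with resultant_sign_pattern_poly_root[OF eq assms(2,3)] show ?thesis by (rule rev_bexI[rotated])
  qed
  have "double_root_params k l \<subseteq> (\<Union>r \<in> Q. {\<mu>. poly r \<mu> = 0})"
    using root by blast
  moreover have "finite (\<Union>r \<in> Q. {\<mu>. poly r \<mu> = 0})"
    by (intro finite_UN_I \<open>finite Q\<close> poly_roots_finite nz)
  ultimately show "finite (double_root_params k l)" by (rule finite_subset)
  show "\<forall>\<mu> \<in> double_root_params k l. algebraic \<mu>"
  proof
    fix \<mu> assume "\<mu> \<in> double_root_params k l"
    from root[OF this] obtain r where r: "r \<in> Q" "poly r \<mu> = 0" by (elim bexE)
    have "coeff r i \<in> \<int>" for i using r(1) by (auto simp: Q_def)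
    then show "algebraic \<mu>" using nz[OF r(1)] r(2) by (rule algebraicI)
  qed
qed

section \<open>Orbits of the plane map\<close>

lemma T_munu_eq:
  "T_munu \<mu> \<nu> (x, y) = ((if x \<ge> 0 then \<nu> + \<mu> else \<nu> - \<mu>) * x - y, x)"
  by (simp add: T_munu_def T_map_def)

lemma T_munu_nonzero: "v \<noteq> 0 \<Longrightarrow> T_munu \<mu> \<nu> v \<noteq> 0"
  by (cases v) (auto simp: T_munu_eq zero_prod_def split: if_splits)

lemma T_munu_iterate_nonzero: "v \<noteq> 0 \<Longrightarrow> (T_munu \<mu> \<nu> ^^ n) v \<noteq> 0"
  by (induction n) (simp_all add: T_munu_nonzero)

lemma T_munu_scale: "0 < c \<Longrightarrow> T_munu \<mu> \<nu> (c *\<^sub>R v) = c *\<^sub>R T_munu \<mu> \<nu> v"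
  by (cases v) (auto simp: T_munu_eq algebra_simps zero_le_mult_iff)

text \<open>The second coordinate is the previous first coordinate, so first coordinates obey the
  continuant recursion, with slope \<nu> + \<mu> or \<nu> - \<mu> according to the side of the
  y-axis. One sign sequence serves all times.\<close>

lemma T_munu_orbit_continuant:
  "\<exists>s :: nat \<Rightarrow> int. range s \<subseteq> {-1, 1} \<and>
    (\<forall>n. fst ((T_munu \<mu> \<nu> ^^ n) (0, y)) = - y * continuant (\<lambda>i. \<nu> + real_of_int (s i) * \<mu>) n)"
proof -
  \<comment> \<open>A zero coordinate gets sign 1, matching the branch \<open>x \<ge> 0\<close> of
    the map.\<close>
  define s :: "nat \<Rightarrow> int" where "s i = (if fst ((T_munu \<mu> \<nu> ^^ i) (0, y)) \<ge> 0 then 1 else -1)" for i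
  let ?X = "continuant (\<lambda>i. \<nu> + real_of_int (s i) * \<mu>)"
  have "(T_munu \<mu> \<nu> ^^ Suc n) (0, y) = (- y * ?X (Suc n), - y * ?X n)" for n
  proof (induction n)
    case (Suc n)
    have "(if - y * ?X (Suc n) \<ge> 0 then \<nu> + \<mu> else \<nu> - \<mu>) = \<nu> + s (Suc n) * \<mu>"
      unfolding s_def[of "Suc n"] Suc by simp
    then show ?case
      unfolding funpow.simps(2)[of "Suc n"] o_apply Suc T_munu_eq by (simp add: algebra_simps)
  qed (simp add: T_munu_eq)
  then have "fst ((T_munu \<mu> \<nu> ^^ n) (0, y)) = - y * ?X n" for n
    by (cases n) (simp_all del: funpow.simps(2))
  moreover have "range s \<subseteq> {-1, 1}" by (auto simp: s_def)
  ultimately show ?thesis by blast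
qed

text \<open>Near a point off the y-axis the map agrees with one of its two linear branches, and
  linear maps compose.\<close>

lemma T_munu_iterate_locally_linear:
  assumes "\<And>i. i < n \<Longrightarrow> fst ((T_munu \<mu> \<nu> ^^ i) w) \<noteq> 0"
  shows "\<exists>P. bounded_linear P \<and> (\<forall>\<^sub>F v in nhds w. (T_munu \<mu> \<nu> ^^ n) v = P v)"
  using assms
proof (induction n)
  case 0
  show ?case by (intro exI[of _ "\<lambda>v. v"]) (simp add: bounded_linear_ident)
next
  case (Suc n)
  then obtain P where P: "bounded_linear P" "\<forall>\<^sub>F v in nhds w. (T_munu \<mu> \<nu> ^^ n) v = P v"
    by auto
  \<comment> \<open>The branch for the side of the axis on which \<open>P w\<close> lies; by
    continuity \<open>P v\<close> lies on the same side for \<open>v\<close> near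
    \<open>w\<close>.\<close>
  define M where "M v = ((if fst (P w) > 0 then \<nu> + \<mu> else \<nu> - \<mu>) * fst v - snd v, fst v)"
    for v :: "real \<times> real"
  have "bounded_linear M"
    unfolding M_def by (intro bounded_linear_Pair bounded_linear_sub bounded_linear_fst bounded_linear_snd
      bounded_linear_const_mult)
  then have "bounded_linear (\<lambda>v. M (P v))" using P(1) by (rule bounded_linear_compose)
  moreover have "fst (P w) \<noteq> 0" using Suc.prems[of n] eventually_nhds_x_imp_x[OF P(2)] by simp
  have "((\<lambda>v. fst (P v)) \<longlongrightarrow> fst (P w)) (nhds w)"
    by (rule tendsto_fst[OF bounded_linear.tendsto[OF P(1) filterlim_ident]])
  then have "\<forall>\<^sub>F v in nhds w. (fst (P w) > 0 \<longrightarrow> fst (P v) > 0) \<and> (fst (P w) < 0 \<longrightarrow> fst (P v) < 0)"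
    using order_tendstoD[of "\<lambda>v. fst (P v)" "fst (P w)" "nhds w" 0]
    by (cases "fst (P w)" "0::real" rule: linorder_cases) auto
  with P(2) have "\<forall>\<^sub>F v in nhds w. (T_munu \<mu> \<nu> ^^ Suc n) v = M (P v)"
  proof eventually_elim
    case (elim v)
    have "T_munu \<mu> \<nu> (P v) = M (P v)"
      using elim(2) \<open>fst (P w) \<noteq> 0\<close> by (cases "P v") (auto simp: M_def T_munu_eq)
    then show ?case using elim(1) by simp
  qed
  ultimately show ?case by (intro exI[of _ "\<lambda>v. M (P v)"] conjI)
qed

text \<open>Otherwise $T_{\mu\nu}^{q-1}$ is linear near $T_{\mu\nu}(0,1)$; evaluating $T_{\mu\nu}^q$ on both sides of the positive
  $y$-axis then forces $\nu+\mu = \nu-\mu$.\<close>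
lemma orbit_returns_to_axis:
  assumes "0 < q" "\<mu> \<noteq> 0"
    and rays: "\<And>v. v \<noteq> 0 \<Longrightarrow> \<exists>c. (T_munu \<mu> \<nu> ^^ q) v = c *\<^sub>R v"
  shows "\<exists>k. 0 < k \<and> k < q \<and> fst ((T_munu \<mu> \<nu> ^^ k) (0, 1)) = 0"
proof (rule ccontr)
  assume none: "\<not> ?thesis"
  let ?T = "T_munu \<mu> \<nu>" and ?w = "(- 1, 0) :: real \<times> real"
  obtain m where q: "q = Suc m" using \<open>0 < q\<close> gr0_implies_Suc by blast
  have Tq: "(?T ^^ q) v = (?T ^^ m) (?T v)" for v unfolding q by (simp add: funpow_swap1)
  have "?T (0, 1) = ?w" by (simp add: T_munu_eq)
  have "fst ((?T ^^ i) ?w) \<noteq> 0" if "i < m" for i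
  proof -
    have "(?T ^^ i) ?w = (?T ^^ Suc i) (0, 1)"
      using \<open>?T (0, 1) = ?w\<close> by (simp add: funpow_swap1)
    then show ?thesis using none that q by (metis Suc_less_eq zero_less_Suc)
  qed
  then obtain P where P: "bounded_linear P" and ev: "\<forall>\<^sub>F v in nhds ?w. (?T ^^ m) v = P v"
    using T_munu_iterate_locally_linear[of m \<mu> \<nu> ?w] by blast
  interpret bounded_linear P by fact
  have Pw: "P ?w = (?T ^^ q) (0, 1)"
    using eventually_nhds_x_imp_x[OF ev] Tq[of "(0, 1)"] \<open>?T (0, 1) = ?w\<close> by simp
  obtain r where l: "P ?w = (0, r)"
    unfolding Pw using rays[of "(0, 1)"] by (auto simp: zero_prod_def)
  have "(?T ^^ q) (0, 1) \<noteq> 0"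
    by (rule T_munu_iterate_nonzero) (simp add: zero_prod_def)
  then have "r \<noteq> 0" using l unfolding Pw by (auto simp: zero_prod_def)
  obtain p s where ps: "P (0, 1) = (p, s)" by (cases "P (0, 1)")
  \<comment> \<open>\<open>P\<close> is determined by its values at \<open>?w\<close> and
    \<open>(0, 1)\<close>; the first is \<open>(0, r)\<close> because it is a multiple of
    \<open>(0, 1)\<close>.\<close>
  have Pxy: "P (x, y) = (y * p, y * s - x * r)" for x y
  proof -
    have "(x, y) = (- x) *\<^sub>R ?w + y *\<^sub>R (0, 1)" by simp
    then have "P (x, y) = (- x) *\<^sub>R P ?w + y *\<^sub>R P (0, 1)" by (simp only: add scaleR)
    then show ?thesis by (simp add: l ps)
  qed
  \<comment> \<open>For \<open>(c, d)\<close> equal to \<open>(\<nu> + \<mu>, 1)\<close> and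
    \<open>(- (\<nu> - \<mu>), - 1)\<close> these points are the images of \<open>(e, 1)\<close> and
    \<open>(- e, 1)\<close>, which lie on opposite sides of the y-axis.\<close>
  have lim: "((\<lambda>e. (c * e - 1, d * e)) \<longlongrightarrow> ?w) (at_right 0)" for c d :: real
    by (rule tendsto_eq_intros refl tendsto_ident_at)+ simp
  have "\<forall>\<^sub>F e in at_right 0. (?T ^^ m) ((\<nu> + \<mu>) * e - 1, 1 * e) = P ((\<nu> + \<mu>) * e - 1, 1 * e)"
    "\<forall>\<^sub>F e in at_right 0. (?T ^^ m) (- (\<nu> - \<mu>) * e - 1, - 1 * e) = P (- (\<nu> - \<mu>) * e - 1, - 1 * e)"
    by (rule eventually_compose_filterlim[OF ev lim])+
  then have "\<forall>\<^sub>F e in at_right (0::real). p = r * (1 - (\<nu> + \<mu>) * e) + s * e \<and>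
      p = r * (1 + (\<nu> - \<mu>) * e) - s * e" (is "eventually ?Q _")
    using eventually_at_right_less[of 0]
  proof eventually_elim
    case (elim e)
    obtain c where c: "(?T ^^ q) (e, 1) = c *\<^sub>R (e, 1)" using rays[of "(e, 1)"] by (auto simp: zero_prod_def)
    obtain d where d: "(?T ^^ q) (- e, 1) = d *\<^sub>R (- e, 1)" using rays[of "(- e, 1)"] by (auto simp: zero_prod_def)
    have "?T (e, 1) = ((\<nu> + \<mu>) * e - 1, 1 * e)" "?T (- e, 1) = (- (\<nu> - \<mu>) * e - 1, - 1 * e)"
      using elim(3) by (simp_all add: T_munu_eq left_diff_distrib)
    with elim(1,2) c d have "P ((\<nu> + \<mu>) * e - 1, 1 * e) = c *\<^sub>R (e, 1)"
      "P (- (\<nu> - \<mu>) * e - 1, - 1 * e) = d *\<^sub>R (- e, 1)"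
      by (simp_all only: Tq)
    \<comment> \<open>First coordinates give \<open>c = p\<close> and \<open>d = p\<close>; second
      coordinates then give the two equations.\<close>
    then show ?case using elim(3) by (auto simp: Pxy algebra_simps)
  qed
  then obtain b where b: "b > 0" "\<And>e. 0 < e \<Longrightarrow> e < b \<Longrightarrow> ?Q e"
    unfolding eventually_at_right_field by blast
  \<comment> \<open>Averaging the two equations cancels \<nu> and \<open>s\<close>. As
    \<open>p\<close> does not depend on \<open>e\<close>, two values of \<open>e\<close> force the
    linear term to vanish.\<close>
  have "p = r - (r * \<mu>) * e" if "0 < e" "e < b" for e
    using b(2)[OF that] by (simp add: algebra_simps)
  from this[of "b / 2"] this[of "b / 4"] \<open>b > 0\<close> have "r * \<mu> * b = 0" by auto
  with \<open>b > 0\<close> \<open>r \<noteq> 0\<close> \<open>\<mu> \<noteq> 0\<close> show False by simp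
qed

text \<open>Cutting the orbit of \<open>(0, 1)\<close> at its return time \<open>k\<close> leaves
  two pieces, of lengths \<open>k\<close> and \<open>q - k\<close>, that both start and end on the
  y-axis; hence both continuants vanish.\<close>

lemma periodic_rays_imp_params:
  assumes "prime q" and "\<mu> \<noteq> 0"
    and rays: "\<And>v. v \<noteq> 0 \<Longrightarrow> \<exists>c. (T_munu \<mu> \<nu> ^^ q) v = c *\<^sub>R v"
  shows "\<exists>k. 0 < k \<and> k < q \<and> \<mu> \<in> double_root_params k (q - k)"
proof -
  let ?T = "T_munu \<mu> \<nu>"
  obtain k where k: "0 < k" "k < q" "fst ((?T ^^ k) (0, 1)) = 0"
    using orbit_returns_to_axis[OF prime_gt_0_nat[OF assms(1)] assms(2) rays] by blast
  obtain y where y: "(?T ^^ k) (0, 1) = (0, y)" using k(3) by (cases "(?T ^^ k) (0, 1)") auto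
  have "(?T ^^ n) (0, 1) \<noteq> 0" for n
    by (rule T_munu_iterate_nonzero) (simp add: zero_prod_def)
  from this[of k] have "y \<noteq> 0" by (auto simp: y zero_prod_def)
  have "(?T ^^ (q - k)) (0, y) = (?T ^^ q) (0, 1)"
    using k(2) funpow_add[of "q - k" k ?T] unfolding y[symmetric] by simp
  then have fst0: "fst ((?T ^^ (q - k)) (0, y)) = 0"
    using rays[of "(0, 1)"] by (auto simp: zero_prod_def)
  obtain s :: "nat \<Rightarrow> int" where s: "range s \<subseteq> {-1, 1}"
      "\<And>n. fst ((?T ^^ n) (0, 1)) = - 1 * continuant (\<lambda>i. \<nu> + real_of_int (s i) * \<mu>) n"
    using T_munu_orbit_continuant[of \<mu> \<nu> 1] by (elim exE conjE) (rule that, assumption, erule spec)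
  obtain t :: "nat \<Rightarrow> int" where t: "range t \<subseteq> {-1, 1}"
      "\<And>n. fst ((?T ^^ n) (0, y)) = - y * continuant (\<lambda>i. \<nu> + real_of_int (t i) * \<mu>) n"
    using T_munu_orbit_continuant[of \<mu> \<nu> y] by (elim exE conjE) (rule that, assumption, erule spec)
  have "continuant (\<lambda>i. \<nu> + real_of_int (s i) * \<mu>) k = 0"
    using s(2)[of k] k(3) by simp
  moreover have "continuant (\<lambda>i. \<nu> + real_of_int (t i) * \<mu>) (q - k) = 0"
    using t(2)[of "q - k"] fst0 \<open>y \<noteq> 0\<close> by simp
  ultimately have "\<mu> \<in> double_root_params k (q - k)"
    unfolding double_root_params_def mem_Collect_eq using s(1) t(1) by (intro exI conjI)
  then show ?thesis using k by blast
qed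

section \<open>Translation and rotation numbers\<close>

locale degree_one_lift =
  fixes F :: "real \<Rightarrow> real"
  assumes mono: "mono F" and shift: "F (t + 1) = F t + 1"
begin

lemma iterate: "degree_one_lift (F ^^ n)"
proof (induction n)
  case 0
  show ?case by unfold_locales (simp_all add: mono_def)
next
  case (Suc n)
  then interpret n: degree_one_lift "F ^^ n" .
  show ?case
    by unfold_locales (auto simp: n.shift shift intro!: monoI monoD[OF mono] monoD[OF n.mono])
qed

lemma shift_int: "F (t + of_int m) = F t + of_int m"
proof (induction m rule: int_induct[where k = 0])
  case (step1 i)
  then show ?case using shift[of "t + of_int i"] by (simp add: add.assoc)
next
  case (step2 i)
  then show ?case using shift[of "t + of_int (i - 1)"] by (simp add: algebra_simps)
qed simp

text \<open>\<open>F\<close> minus the identity equals \<open>F 0\<close> at the integers on either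
  side of \<open>t\<close>, and \<open>F\<close> is monotone in between.\<close>

lemma displacement_bound: "\<bar>F t - t - F 0\<bar> \<le> 1"
proof -
  have "F (of_int \<lfloor>t\<rfloor>) \<le> F t" "F t \<le> F (of_int (\<lfloor>t\<rfloor> + 1))"
    by (intro monoD[OF mono]; linarith)+
  then show ?thesis using shift_int[of 0 "\<lfloor>t\<rfloor>"] shift_int[of 0 "\<lfloor>t\<rfloor> + 1"] by simp linarith
qed

text \<open>Each of the \<open>m\<close> applications of \<open>F ^^ n\<close> adds
  \<open>(F ^^ n) 0\<close> with an error of at most 1.\<close>

lemma iterate_mult_bound: "\<bar>(F ^^ (m * n)) 0 - real m * (F ^^ n) 0\<bar> \<le> m"
proof (induction m)
  case (Suc m)
  have "(F ^^ (Suc m * n)) 0 = (F ^^ n) ((F ^^ (m * n)) 0)" by (simp add: funpow_add)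
  with degree_one_lift.displacement_bound[OF iterate, of n "(F ^^ (m * n)) 0"] Suc
  show ?case by (simp add: algebra_simps)
qed simp

text \<open>Both averages are compared through the common iterate
  \<open>(F ^^ (m * n)) 0\<close>.\<close>

lemma mean_displacement_diff:
  assumes "0 < m" "0 < n"
  shows "\<bar>(F ^^ m) 0 / m - (F ^^ n) 0 / n\<bar> \<le> 1 / m + 1 / n"
proof -
  have "\<bar>real m * (F ^^ n) 0 - real n * (F ^^ m) 0\<bar> \<le> real m + real n"
    using iterate_mult_bound[of m n] iterate_mult_bound[of n m] by (simp add: mult.commute)
  moreover have "(F ^^ m) 0 / m - (F ^^ n) 0 / n = (real n * (F ^^ m) 0 - real m * (F ^^ n) 0) / (real m * real n)"
    using assms by (simp add: field_simps)
  moreover have "1 / m + 1 / n = (real m + real n) / (real m * real n)"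
    using assms by (simp add: field_simps)
  ultimately show ?thesis
    by (simp only: abs_divide abs_minus_commute) (simp add: divide_right_mono)
qed

text \<open>The averages form a Cauchy sequence, so the \<open>lim\<close> in the definition is a
  genuine limit.\<close>

lemma translation_number_LIMSEQ: "(\<lambda>n. (F ^^ n) 0 / real n) \<longlonglongrightarrow> translation_number F"
proof -
  have "Cauchy (\<lambda>n. (F ^^ n) 0 / real n)"
  proof (rule metric_CauchyI)
    fix e :: real assume "e > 0"
    then obtain N :: nat where N: "0 < N" "1 / N < e / 2"
      using real_arch_inverse[of "e / 2"] by (auto simp: inverse_eq_divide)
    show "\<exists>M. \<forall>m\<ge>M. \<forall>n\<ge>M. dist ((F ^^ m) 0 / real m) ((F ^^ n) 0 / real n) < e"
    proof (intro exI allI impI)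
      fix m n assume "N \<le> m" "N \<le> n"
      with N(1) have "1 / m \<le> 1 / N" "1 / n \<le> 1 / N" by (simp_all add: frac_le)
      with mean_displacement_diff[of m n] N \<open>N \<le> m\<close> \<open>N \<le> n\<close>
      show "dist ((F ^^ m) 0 / real m) ((F ^^ n) 0 / real n) < e" by (simp add: dist_real_def)
    qed
  qed
  then show ?thesis
    unfolding translation_number_def by (simp only: Cauchy_convergent flip: convergent_LIMSEQ_iff)
qed

text \<open>Letting one index tend to infinity in the comparison of averages costs 1 at the base
  point 0; passing from 0 to \<open>t\<close> costs 1 more.\<close>

lemma iterate_translation_bound: "\<bar>(F ^^ n) t - t - n * translation_number F\<bar> \<le> 2"
proof (cases "n = 0")
  case False
  have "(\<lambda>m. \<bar>(F ^^ m) 0 / m - (F ^^ n) 0 / n\<bar>) \<longlonglongrightarrow> \<bar>translation_number F - (F ^^ n) 0 / n\<bar>"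
    by (rule tendsto_rabs[OF tendsto_diff[OF translation_number_LIMSEQ tendsto_const]])
  moreover have "(\<lambda>m. 1 / real m + 1 / n) \<longlonglongrightarrow> 0 + 1 / n"
    by (rule tendsto_add[OF lim_1_over_n tendsto_const])
  ultimately have "\<bar>translation_number F - (F ^^ n) 0 / n\<bar> \<le> 0 + 1 / n"
    by (rule LIMSEQ_le) (use mean_displacement_diff False in \<open>auto intro!: exI[of _ 1]\<close>)
  then have "n * \<bar>translation_number F - (F ^^ n) 0 / n\<bar> \<le> n * (1 / n)"
    by (intro mult_left_mono) simp_all
  then have "\<bar>n * translation_number F - (F ^^ n) 0\<bar> \<le> 1"
    using False by (simp add: abs_mult_pos' right_diff_distrib flip: abs_mult)
  with degree_one_lift.displacement_bound[OF iterate, of n t] show ?thesis by linarith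
qed simp

section \<open>Iterates compared with integer translations\<close>

lemma iterate_period_bounds:
  shows "t + real_of_int J \<le> (F ^^ q) t \<Longrightarrow> t + real n * real_of_int J \<le> (F ^^ (n * q)) t"
    and "(F ^^ q) t \<le> t + real_of_int J \<Longrightarrow> (F ^^ (n * q)) t \<le> t + real n * real_of_int J"
proof -
  interpret q: degree_one_lift "F ^^ q" by (rule iterate)
  have *: "(F ^^ (Suc n * q)) t = (F ^^ q) ((F ^^ (n * q)) t)" for n by (simp add: funpow_add)
  have **: "(F ^^ q) (t + real n * J) = (F ^^ q) t + real n * J" for n
    using q.shift_int[of t "int n * J"] by simp
  show "t + real n * J \<le> (F ^^ (n * q)) t" if "t + J \<le> (F ^^ q) t"
  proof (induction n)
    case (Suc n)
    from monoD[OF q.mono this] that show ?case unfolding * ** by (simp add: algebra_simps)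
  qed simp
  show "(F ^^ (n * q)) t \<le> t + real n * J" if "(F ^^ q) t \<le> t + J"
  proof (induction n)
    case (Suc n)
    from monoD[OF q.mono this] that show ?case unfolding * ** by (simp add: algebra_simps)
  qed simp
qed

text \<open>After \<open>n * q\<close> iterations \<open>t\<close> has moved by at least
  \<open>n * J\<close>, yet within 2 of \<open>n * q\<close> times the translation number; a smaller
  translation number fails for large \<open>n\<close>.\<close>

lemma translation_number_ge:
  assumes "t + real_of_int J \<le> (F ^^ q) t"
  shows "real_of_int J \<le> q * translation_number F"
proof (rule ccontr)
  assume "\<not> ?thesis"
  then obtain n :: nat where "2 < real n * (J - q * translation_number F)"
    using reals_Archimedean3[of "J - q * translation_number F"] by auto
  moreover have "real n * J \<le> real (n * q) * translation_number F + 2"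
    using iterate_period_bounds(1)[OF assms, of n] iterate_translation_bound[of "n * q" t] by linarith
  ultimately show False by (simp add: algebra_simps)
qed

lemma translation_number_le:
  assumes "(F ^^ q) t \<le> t + real_of_int J"
  shows "q * translation_number F \<le> real_of_int J"
proof (rule ccontr)
  assume "\<not> ?thesis"
  then obtain n :: nat where "2 < real n * (q * translation_number F - J)"
    using reals_Archimedean3[of "q * translation_number F - J"] by auto
  moreover have "real (n * q) * translation_number F \<le> real n * J + 2"
    using iterate_period_bounds(2)[OF assms, of n] iterate_translation_bound[of "n * q" t] by linarith
  ultimately show False by (simp add: algebra_simps)
qed

text \<open>This makes the fractional part independent of the chosen lift.\<close>

lemma translation_number_add_int:
  "translation_number (\<lambda>t. F t + real_of_int m) = translation_number F + m"
proof -
  have "((\<lambda>t. F t + of_int m) ^^ n) 0 = (F ^^ n) 0 + real n * m" for n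
  proof (induction n)
    case (Suc n)
    then show ?case using shift_int[of "(F ^^ n) 0" "int n * m"] by (simp add: algebra_simps)
  qed simp
  moreover have "(\<lambda>n. ((F ^^ n) 0 + real n * m) / real n) \<longlonglongrightarrow> translation_number F + m"
  proof (rule Lim_transform_eventually)
    show "(\<lambda>n. (F ^^ n) 0 / real n + m) \<longlonglongrightarrow> translation_number F + m"
      by (rule tendsto_add[OF translation_number_LIMSEQ tendsto_const])
    show "\<forall>\<^sub>F n in sequentially. (F ^^ n) 0 / real n + m = ((F ^^ n) 0 + real n * m) / real n"
      using eventually_gt_at_top[of 0] by (rule eventually_mono) (simp add: add_divide_distrib)
  qed
  ultimately show ?thesis unfolding translation_number_def[of "\<lambda>t. F t + of_int m"] by (simp add: limI)
qed

end

lemma translation_number_mono: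
  assumes "degree_one_lift F" "degree_one_lift G" "\<And>t. F t \<le> G t"
  shows "translation_number F \<le> translation_number G"
proof -
  have "(F ^^ n) 0 \<le> (G ^^ n) 0" for n
  proof (induction n)
    case (Suc n)
    have "F ((F ^^ n) 0) \<le> F ((G ^^ n) 0)" using Suc assms(1) by (simp add: degree_one_lift.mono monoD)
    also have "\<dots> \<le> G ((G ^^ n) 0)" by (rule assms)
    finally show ?case by simp
  qed simp
  then show ?thesis
    using LIMSEQ_le[OF degree_one_lift.translation_number_LIMSEQ[OF assms(1)]
        degree_one_lift.translation_number_LIMSEQ[OF assms(2)]]
    by (simp add: divide_right_mono)
qed

section \<open>Lifts of circle maps and the rotation number\<close>

lemma circle_point_eq_iff: "circle_point s = circle_point t \<longleftrightarrow> (\<exists>m::int. s = t + m)"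
proof -
  have "circle_point s = circle_point t \<longleftrightarrow> (\<exists>m::int. 2 * pi * s = 2 * pi * t + 2 * pi * m)"
    using sin_cos_eq_iff[of "2 * pi * s" "2 * pi * t"] unfolding circle_point_def by (auto simp: ac_simps)
  also have "\<dots> \<longleftrightarrow> (\<exists>m::int. s = t + m)"
    by (simp flip: distrib_left)
  finally show ?thesis .
qed

lemma is_lift_degree_one: "is_lift F S \<Longrightarrow> degree_one_lift F"
  by unfold_locales (auto simp: is_lift_def strict_mono_mono)

text \<open>The difference of two lifts is continuous and integer-valued, hence constant on the
  line.\<close>

lemma is_lift_unique:
  assumes "is_lift F S" "is_lift G S"
  shows "\<exists>m::int. G = (\<lambda>t. F t + m)"
proof -
  have int: "\<exists>m::int. G t - F t = m" for t
    using assms circle_point_eq_iff[of "G t" "F t"] unfolding is_lift_def by force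
  have "(\<lambda>t. G t - F t) constant_on UNIV"
  proof (rule continuous_discrete_range_constant)
    show "continuous_on UNIV (\<lambda>t. G t - F t)"
      using assms by (intro continuous_on_diff) (auto simp: is_lift_def)
    show "\<exists>e>0. \<forall>u. u \<in> UNIV \<and> G u - F u \<noteq> G t - F t \<longrightarrow> e \<le> norm (G u - F u - (G t - F t))" for t
    proof (intro exI[of _ 1] conjI allI impI)
      fix u assume u: "u \<in> UNIV \<and> G u - F u \<noteq> G t - F t"
      obtain m n :: int where "G u - F u = m" "G t - F t = n" using int by blast
      with u show "1 \<le> norm (G u - F u - (G t - F t))" by (simp flip: of_int_diff)
    qed simp
  qed simp
  then obtain d where "\<And>t. G t - F t = d" by (auto simp: constant_on_def)
  with int[of 0] obtain m :: int where "\<And>t. G t - F t = m" by auto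
  then show ?thesis by (intro exI[of _ m] ext) (simp add: algebra_simps)
qed

lemma rotation_number_eq:
  assumes "is_lift F S"
  shows "rotation_number S = frac (translation_number F)"
  unfolding rotation_number_def
proof (rule the_equality)
  fix r assume "\<exists>G. is_lift G S \<and> r = frac (translation_number G)"
  then obtain G where G: "is_lift G S" "r = frac (translation_number G)" by blast
  from is_lift_unique[OF assms G(1)] obtain m :: int where "G = (\<lambda>t. F t + m)" ..
  then show "r = frac (translation_number F)"
    using G(2) degree_one_lift.translation_number_add_int[OF is_lift_degree_one[OF assms], of m]
    by (simp add: frac_def)
qed (use assms in blast)

section \<open>The lift of the circle map\<close>

text \<open>The term \<open>a * x\<close> or \<open>b * x\<close> of the plane map, written without
  a case split.\<close>

definition kink :: "real \<Rightarrow> real \<Rightarrow> real \<Rightarrow> real" where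
  "kink \<mu> \<nu> x = \<nu> * x + \<mu> * \<bar>x\<bar>"

text \<open>For $u = e^{2\pi i t}$, seen as a complex number, $T_{\mu\nu}(u) = i\,u\,z$ with the shear factor $z$. Since $z$
  avoids the closed negative real axis, the principal branch of its argument gives a continuous lift.\<close>
definition shear_factor :: "real \<Rightarrow> real \<Rightarrow> real \<Rightarrow> complex" where
  "shear_factor \<mu> \<nu> t = 1 - \<i> * of_real (kink \<mu> \<nu> (cos (2 * pi * t))) * cis (- (2 * pi * t))"

text \<open>\<open>Im (Ln z)\<close> is the principal argument of \<open>z\<close>, and
  \<open>1 / 4\<close> is the quarter turn from the factor \<open>i\<close>; angles are counted in
  full turns.\<close>

definition munu_lift :: "real \<Rightarrow> real \<Rightarrow> real \<Rightarrow> real" where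
  "munu_lift \<mu> \<nu> t = t + 1 / 4 + Im (Ln (shear_factor \<mu> \<nu> t)) / (2 * pi)"

lemma T_munu_kink: "T_munu \<mu> \<nu> (x, y) = (kink \<mu> \<nu> x - y, x)"
  by (simp add: T_munu_eq kink_def algebra_simps)

lemma inj_T_munu: "inj (T_munu \<mu> \<nu>)"
  by (rule injI) (auto simp: T_munu_kink)

text \<open>The imaginary part is minus the kink times the cosine. If it vanishes, so does the kink,
  and the factor is 1.\<close>

lemma shear_factor_slit: "shear_factor \<mu> \<nu> t \<notin> \<real>\<^sub>\<le>\<^sub>0"
proof
  assume "shear_factor \<mu> \<nu> t \<in> \<real>\<^sub>\<le>\<^sub>0"
  then have "Im (shear_factor \<mu> \<nu> t) = 0" "Re (shear_factor \<mu> \<nu> t) \<le> 0"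
    by (simp_all add: complex_nonpos_Reals_iff)
  moreover from this(1) have "kink \<mu> \<nu> (cos (2 * pi * t)) = 0"
    by (auto simp: shear_factor_def kink_def)
  ultimately show False by (simp add: shear_factor_def)
qed

lemma circle_point_eq_Re_Im: "circle_point t = (Re (cis (2 * pi * t)), Im (cis (2 * pi * t)))"
  by (simp add: circle_point_def)

lemma circle_point_munu_lift: "circle_point (munu_lift \<mu> \<nu> t) = S_munu \<mu> \<nu> (circle_point t)"
proof -
  let ?z = "shear_factor \<mu> \<nu> t"
  define w where "w = \<i> * cis (2 * pi * t) * ?z"
  have nz: "?z \<noteq> 0" using shear_factor_slit[of \<mu> \<nu> t] by auto
  \<comment> \<open>The two factors \<open>cis\<close> cancel, so the shear only adds the real
    number \<open>kink\<close> to \<open>i\<close> times the circle point.\<close>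
  have w: "w = Complex (kink \<mu> \<nu> (cos (2 * pi * t)) - sin (2 * pi * t)) (cos (2 * pi * t))"
  proof -
    have "w = \<i> * cis (2 * pi * t) + of_real (kink \<mu> \<nu> (cos (2 * pi * t))) * (cis (2 * pi * t) * cis (- (2 * pi * t)))"
      unfolding w_def shear_factor_def by (simp add: algebra_simps)
    then show ?thesis by (simp add: cis_mult complex_eq_iff)
  qed
  have "2 * pi * munu_lift \<mu> \<nu> t = 2 * pi * t + (pi / 2 + Arg ?z)"
    using nz by (simp add: munu_lift_def Arg_def distrib_left)
  then have "cis (2 * pi * munu_lift \<mu> \<nu> t) = \<i> * cis (2 * pi * t) * (?z / of_real (cmod ?z))"
    using nz by (simp add: cis_mult[symmetric] cis_Arg sgn_eq)
  also have "\<dots> = w / of_real (cmod w)" by (simp add: w_def norm_mult)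
  also have "\<dots> = w /\<^sub>R cmod w" by (simp add: scaleR_conv_of_real divide_inverse mult.commute)
  finally show ?thesis
    unfolding circle_point_eq_Re_Im S_munu_def
    by (simp add: w circle_point_def T_munu_kink norm_Pair complex_norm)
qed

lemma norm_circle_point: "norm (circle_point t) = 1"
  by (simp add: circle_point_def norm_Pair)

text \<open>If the images have equal directions, positive homogeneity and injectivity of the plane
  map make \<open>v\<close> a positive multiple of \<open>u\<close>; equal norms finish.\<close>

lemma S_munu_inj:
  assumes "norm u = 1" "norm v = 1" "S_munu \<mu> \<nu> u = S_munu \<mu> \<nu> v"
  shows "u = v"
proof -
  let ?T = "T_munu \<mu> \<nu>"
  have "?T u \<noteq> 0" "?T v \<noteq> 0" using assms(1,2) by (auto intro!: T_munu_nonzero)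
  define c where "c = norm (?T v) / norm (?T u)"
  have "c > 0" using \<open>?T u \<noteq> 0\<close> \<open>?T v \<noteq> 0\<close> by (simp add: c_def)
  have "?T v = norm (?T v) *\<^sub>R S_munu \<mu> \<nu> v" using \<open>?T v \<noteq> 0\<close> by (simp add: S_munu_def)
  also have "\<dots> = c *\<^sub>R ?T u" 
    by (simp only: assms(3)[symmetric]) (simp add: S_munu_def c_def divide_inverse)
  also have "\<dots> = ?T (c *\<^sub>R u)" using \<open>c > 0\<close> by (simp add: T_munu_scale)
  finally have "v = c *\<^sub>R u" using inj_T_munu by (simp add: inj_eq)
  with assms(1,2) \<open>c > 0\<close> show ?thesis by simp
qed

text \<open>Continuity is joint in \<nu> and \<open>t\<close>, so that iterates of the lift also
  depend continuously on \<nu>.\<close>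

lemma continuous_munu_lift: "continuous_on UNIV (\<lambda>p. munu_lift \<mu> (fst p) (snd p))"
  unfolding munu_lift_def
  by (intro continuous_intros) (auto simp: shear_factor_slit, auto simp: shear_factor_def kink_def intro!: continuous_intros)

lemma munu_lift_shift: "munu_lift \<mu> \<nu> (t + 1) = munu_lift \<mu> \<nu> t + 1"
proof -
  have "cis (- (2 * pi * (t + 1))) = cis (- (2 * pi * t))" "cos (2 * pi * (t + 1)) = cos (2 * pi * t)"
    by (simp_all add: distrib_left complex_eq_iff cos_diff sin_diff)
  then show ?thesis by (simp add: munu_lift_def shear_factor_def)
qed

text \<open>Injectivity on the circle and the shift rule make the lift injective. A continuous
  injective function is monotone on intervals, and the shift by \<open>n\<close> fixes the
  direction.\<close>

lemma strict_mono_munu_lift: "strict_mono (munu_lift \<mu> \<nu>)"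
proof -
  let ?F = "munu_lift \<mu> \<nu>"
  have shift_nat: "?F (t + real n) = ?F t + n" for t n
  proof (induction n)
    case (Suc n)
    then show ?case using munu_lift_shift[of \<mu> \<nu> "t + real n"] by (simp add: add_ac)
  qed simp
  have shift_int: "?F (t + of_int m) = ?F t + m" for t m
  proof (cases m rule: int_cases2)
    case (nonpos n)
    then show ?thesis using shift_nat[of "t - n" n] by simp
  qed (simp add: shift_nat)
  have "inj ?F"
  proof (rule injI)
    fix s t assume eq: "?F s = ?F t"
    then have "circle_point s = circle_point t"
      using S_munu_inj[OF norm_circle_point norm_circle_point, of \<mu> \<nu> s t] by (simp flip: circle_point_munu_lift)
    then obtain m :: int where "s = t + m" unfolding circle_point_eq_iff by blast
    with eq show "s = t" by (simp add: shift_int)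
  qed
  show ?thesis
  proof (rule strict_monoI)
    fix s t :: real assume "s < t"
    obtain n :: nat where n: "t - s < n" using reals_Archimedean2 by blast
    have "continuous_on {s..s + n} ?F"
      using continuous_on_compose2[OF continuous_munu_lift[of \<mu>], of "{s..s + n}" "\<lambda>t. (\<nu>, t)"]
      by (simp add: continuous_intros)
    from continuous_inj_imp_mono[OF \<open>s < t\<close> _ this] n \<open>inj ?F\<close> shift_nat[of s n]
    show "?F s < ?F t" by (auto simp: inj_on_def)
  qed
qed

lemma is_lift_munu: "is_lift (munu_lift \<mu> \<nu>) (S_munu \<mu> \<nu>)"
  unfolding is_lift_def
  using strict_mono_munu_lift munu_lift_shift circle_point_munu_lift
    continuous_on_compose2[OF continuous_munu_lift[of \<mu>], of UNIV "\<lambda>t. (\<nu>, t)"]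
  by (simp add: continuous_intros)

text \<open>The argument of the shear factor \<open>z\<close> has \<nu>-derivative
  \<open>Im (z' / z)\<close>, which is minus a square.\<close>

lemma munu_lift_antimono:
  assumes "\<nu> \<le> \<nu>'"
  shows "munu_lift \<mu> \<nu>' t \<le> munu_lift \<mu> \<nu> t"
proof -
  let ?x = "cos (2 * pi * t)" and ?e = "cis (- (2 * pi * t))"
  have "Im (Ln (shear_factor \<mu> \<nu>' t)) \<le> Im (Ln (shear_factor \<mu> \<nu> t))"
  proof (rule DERIV_nonpos_imp_nonincreasing[OF assms])
    fix n :: real
    let ?z = "shear_factor \<mu> n t"
    have "((\<lambda>n. shear_factor \<mu> n t) has_vector_derivative (- \<i> * of_real ?x * ?e)) (at n)"
      unfolding shear_factor_def kink_def
      by (auto intro!: derivative_eq_intros simp: has_real_derivative_iff_has_vector_derivative[symmetric])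
    from field_vector_diff_chain_at[OF this has_field_derivative_Ln[OF shear_factor_slit]]
    have "((\<lambda>n. Im (Ln (shear_factor \<mu> n t))) has_vector_derivative
        Im (- \<i> * of_real ?x * ?e * inverse ?z)) (at n)"
      unfolding o_def by (rule bounded_linear.has_vector_derivative[OF bounded_linear_Im])
    moreover have "Im (- \<i> * of_real ?x * ?e * inverse ?z) = - (?x / cmod ?z)\<^sup>2"
    proof -
      \<comment> \<open>After multiplication by the conjugate of \<open>z\<close>, the kink
        contributes only a real term.\<close>
      have "Im (- \<i> * of_real ?x * ?e * cnj ?z) = - ?x\<^sup>2 "
        by (simp add: shear_factor_def kink_def power2_eq_square algebra_simps)
      moreover have "inverse ?z = cnj ?z / of_real ((cmod ?z)\<^sup>2)"
        using complex_div_cnj[of 1 ?z] by (simp add: inverse_eq_divide)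
      ultimately show ?thesis by (simp add: power_divide)
    qed
    ultimately show "\<exists>y. ((\<lambda>n. Im (Ln (shear_factor \<mu> n t))) has_real_derivative y) (at n) \<and> y \<le> 0"
      unfolding has_real_derivative_iff_has_vector_derivative by force
  qed
  then show ?thesis by (simp add: munu_lift_def divide_right_mono)
qed

lemma continuous_munu_lift_iterate: "continuous_on UNIV (\<lambda>\<nu>. (munu_lift \<mu> \<nu> ^^ n) t)"
proof (induction n)
  case (Suc n)
  show ?case
    using continuous_on_compose2[OF continuous_munu_lift[of \<mu>], of UNIV "\<lambda>\<nu>. (\<nu>, (munu_lift \<mu> \<nu> ^^ n) t)"] Suc
    by (simp add: continuous_intros)
qed (simp add: continuous_intros)

section \<open>From rigid lifts to fixed rays\<close>

lemma S_munu_iterate: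
  assumes "norm u = 1"
  shows "(S_munu \<mu> \<nu> ^^ n) u = (T_munu \<mu> \<nu> ^^ n) u /\<^sub>R norm ((T_munu \<mu> \<nu> ^^ n) u)"
proof (induction n)
  case (Suc n)
  let ?v = "(T_munu \<mu> \<nu> ^^ n) u"
  have "u \<noteq> 0" using assms by auto
  then have "?v \<noteq> 0" by (rule T_munu_iterate_nonzero)
  with Suc show ?case
    using T_munu_scale[of "inverse (norm ?v)" \<mu> \<nu> ?v] by (simp add: S_munu_def)
qed (use assms in simp)

text \<open>An integer translation upstairs is the identity on the circle; positive homogeneity then
  undoes the normalization.\<close>

lemma rigid_lift_imp_rays_fixed:
  assumes "\<And>t. (munu_lift \<mu> \<nu> ^^ q) t = t + of_int J" and "v \<noteq> 0"
  shows "\<exists>c. (T_munu \<mu> \<nu> ^^ q) v = c *\<^sub>R v"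
proof -
  let ?u = "v /\<^sub>R norm v"
  have "norm ?u = 1" using assms(2) by simp
  then have "(fst ?u)\<^sup>2 + (snd ?u)\<^sup>2 = 1" by (simp add: norm_prod_def)
  then obtain a where "fst ?u = cos a" "snd ?u = sin a" by (rule sincos_total_2pi)
  then have u: "?u = circle_point (a / (2 * pi))" by (simp add: circle_point_def prod_eq_iff)
  have "(S_munu \<mu> \<nu> ^^ n) (circle_point t) = circle_point ((munu_lift \<mu> \<nu> ^^ n) t)" for n t
    by (induction n) (simp_all add: circle_point_munu_lift)
  with assms(1) have "(S_munu \<mu> \<nu> ^^ q) ?u = ?u"
    unfolding u by (auto simp: circle_point_eq_iff)
  then have "?u = (T_munu \<mu> \<nu> ^^ q) ?u /\<^sub>R norm ((T_munu \<mu> \<nu> ^^ q) ?u)"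
    using S_munu_iterate[OF \<open>norm ?u = 1\<close>] by simp
  moreover have "(T_munu \<mu> \<nu> ^^ q) ?u \<noteq> 0"
    using assms(2) by (intro T_munu_iterate_nonzero) simp
  ultimately have "norm ((T_munu \<mu> \<nu> ^^ q) ?u) *\<^sub>R ?u = (T_munu \<mu> \<nu> ^^ q) ?u"
    by (metis norm_eq_zero right_inverse scaleR_one scaleR_scaleR)
  moreover have "(T_munu \<mu> \<nu> ^^ n) (c *\<^sub>R w) = c *\<^sub>R (T_munu \<mu> \<nu> ^^ n) w" if "0 < c" for n c w
    by (induction n) (simp_all add: T_munu_scale that)
  from this[of "norm v" q ?u] have "(T_munu \<mu> \<nu> ^^ q) v = norm v *\<^sub>R (T_munu \<mu> \<nu> ^^ q) ?u"
    using assms(2) by simp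
  ultimately have "(T_munu \<mu> \<nu> ^^ q) v = norm v *\<^sub>R norm ((T_munu \<mu> \<nu> ^^ q) ?u) *\<^sub>R ?u"
    by simp
  also have "\<dots> = norm ((T_munu \<mu> \<nu> ^^ q) ?u) *\<^sub>R v"
    using assms(2) by simp
  finally show ?thesis ..
qed

text \<open>A strict inequality at some \<open>t\<close> survives a small change of \<nu> and bounds
  the translation number from one side; in the right direction, antimonotonicity bounds it from the
  other, which yields a second point of the interval.\<close>

lemma degenerate_imp_rigid:
  assumes "0 < q" and "\<mu> \<in> degenerate_params (real_of_int j / real q)"
  shows "\<exists>\<nu> J. \<forall>t. (munu_lift \<mu> \<nu> ^^ q) t = t + of_int J"
proof -
  let ?F = "munu_lift \<mu>" and ?r = "real_of_int j / real q"
  let ?\<tau> = "\<lambda>\<nu>. translation_number (?F \<nu>)"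
  obtain \<nu> where single: "rotation_interval \<mu> ?r = {\<nu>}"
    using assms(2) by (auto simp: degenerate_params_def is_singleton_def)
  have rot: "\<nu>' \<in> rotation_interval \<mu> ?r \<longleftrightarrow> frac (?\<tau> \<nu>') = ?r" for \<nu>'
    by (simp add: rotation_interval_def rotation_number_eq[OF is_lift_munu])
  have only: "\<nu>' = \<nu>" if "?\<tau> \<nu>' = ?\<tau> \<nu>" for \<nu>'
    using rot[of \<nu>] rot[of \<nu>'] that single by auto
  have deg: "degree_one_lift (?F \<nu>')" for \<nu>' using is_lift_munu by (rule is_lift_degree_one)
  \<comment> \<open>The rotation number is only the fractional part; the whole turns of this lift
    are added back to the numerator \<open>j\<close>.\<close>
  define J where "J = j + int q * \<lfloor>?\<tau> \<nu>\<rfloor>"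
  have J: "real_of_int J = q * ?\<tau> \<nu>"
  proof -
    have "?\<tau> \<nu> = ?r + \<lfloor>?\<tau> \<nu>\<rfloor>" using rot[of \<nu>] single by (simp add: frac_def)
    then have "q * ?\<tau> \<nu> = q * (?r + \<lfloor>?\<tau> \<nu>\<rfloor>)" by (rule arg_cong)
    then show ?thesis using assms(1) by (simp add: J_def distrib_left)
  qed
  have cont: "((\<lambda>\<nu>'. (?F \<nu>' ^^ q) t) \<longlongrightarrow> (?F \<nu> ^^ q) t) (at \<nu> within A)" for t A
    using continuous_munu_lift_iterate continuous_on_subset unfolding continuous_on_def
    by (meson UNIV_I subset_UNIV tendsto_within_subset)
  have "(?F \<nu> ^^ q) t = t + of_int J" for t
  proof (rule ccontr)
    assume "(?F \<nu> ^^ q) t \<noteq> t + of_int J"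
    then consider "t + of_int J < (?F \<nu> ^^ q) t" | "(?F \<nu> ^^ q) t < t + of_int J" by linarith
    then show False
    proof cases
      \<comment> \<open>Raising \<nu> cannot increase the translation number, while the surviving
        inequality prevents a decrease.\<close>
      case 1
      have "\<forall>\<^sub>F \<nu>' in at_right \<nu>. t + of_int J < (?F \<nu>' ^^ q) t"
        using order_tendstoD(1)[OF cont 1] .
      moreover have "\<forall>\<^sub>F \<nu>' in at_right \<nu>. \<nu> < \<nu>'" by (rule eventually_at_right_less)
      ultimately obtain \<nu>' where \<nu>': "\<nu> < \<nu>'" "t + of_int J < (?F \<nu>' ^^ q) t"
        using eventually_happens'[OF trivial_limit_at_right_real] eventually_conj by blast
      have "q * ?\<tau> \<nu> \<le> q * ?\<tau> \<nu>'"
        using degree_one_lift.translation_number_ge[OF deg[of \<nu>'], of t J q] \<nu>'(2) J by simp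
      moreover have "?\<tau> \<nu>' \<le> ?\<tau> \<nu>"
        using \<nu>'(1) by (intro translation_number_mono deg munu_lift_antimono) simp
      ultimately show False using only[of \<nu>'] \<nu>'(1) assms(1) by simp
    next
      \<comment> \<open>The mirror image, with \<nu> lowered.\<close>
      case 2
      have "\<forall>\<^sub>F \<nu>' in at_left \<nu>. (?F \<nu>' ^^ q) t < t + of_int J"
        using order_tendstoD(2)[OF cont 2] .
      moreover have "\<forall>\<^sub>F \<nu>' in at_left \<nu>. \<nu>' < \<nu>" by (simp add: eventually_at_filter)
      ultimately obtain \<nu>' where \<nu>': "\<nu>' < \<nu>" "(?F \<nu>' ^^ q) t < t + of_int J"
        using eventually_happens'[OF trivial_limit_at_left_real] eventually_conj by blast
      have "q * ?\<tau> \<nu>' \<le> q * ?\<tau> \<nu>"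
        using degree_one_lift.translation_number_le[OF deg[of \<nu>'], of q t J] \<nu>'(2) J by simp
      moreover have "?\<tau> \<nu> \<le> ?\<tau> \<nu>'"
        using \<nu>'(1) by (intro translation_number_mono deg munu_lift_antimono) simp
      ultimately show False using only[of \<nu>'] \<nu>'(1) assms(1) by simp
    qed
  qed
  then show ?thesis by blast
qed

section \<open>Degenerate parameters\<close>

theorem theorem4p2:
  fixes q :: nat and j :: int
  assumes "prime q" and "q \<ge> 3"
    and "1 \<le> j" and "real_of_int j \<le> (real q - 1) / 2"
  shows "finite (degenerate_params (real_of_int j / real q)) \<and>
         (\<forall>\<mu> \<in> degenerate_params (real_of_int j / real q). algebraic \<mu>)"
proof -
  \<comment> \<open>The parameter 0 is listed separately: there the map has no kink, so no return to
    the axis is forced.\<close>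
  let ?D = "insert 0 (\<Union>k\<in>{0<..<q}. double_root_params k (q - k))"
  have coprime: "coprime k (q - k)" if "k \<in> {0<..<q}" for k
  proof -
    have "coprime q k"
      using that assms(1) by (intro prime_imp_coprime) (auto dest: dvd_imp_le)
    then show ?thesis
      using that gcd_diff1_nat[of k q] by (simp add: coprime_iff_gcd_eq_1 gcd.commute)
  qed
  note dr = finite_algebraic_double_root_params[OF coprime]
  have sub: "degenerate_params (real_of_int j / real q) \<subseteq> ?D"
  proof
    fix \<mu> assume "\<mu> \<in> degenerate_params (real_of_int j / real q)"
    from degenerate_imp_rigid[OF prime_gt_0_nat[OF assms(1)] this]
    obtain \<nu> J where "\<And>t. (munu_lift \<mu> \<nu> ^^ q) t = t + of_int J"
      by (elim exE) (rule that, erule spec)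
    then have rays: "\<And>v. v \<noteq> 0 \<Longrightarrow> \<exists>c. (T_munu \<mu> \<nu> ^^ q) v = c *\<^sub>R v"
      by (rule rigid_lift_imp_rays_fixed)
    show "\<mu> \<in> ?D"
    proof (cases "\<mu> = 0")
      case False
      from periodic_rays_imp_params[OF assms(1) this rays] show ?thesis by (auto intro!: insertI2)
    qed simp
  qed
  moreover have "finite ?D" using dr(1) by auto
  moreover have "\<forall>\<mu>\<in>?D. algebraic \<mu>" using dr(2) by auto
  ultimately show ?thesis using finite_subset by blast
qed

end
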